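(* Let $n,m\ge2$ be integers and let $a_1,\dots,a_{n+m}$ be real numbers with $0\le a_i\le1$ for all $i$ and $a_n+a_{n+m}\le1$. Put $\bar a_i=1-a_i$ for $i\neq n,n+m$ and $\bar a_n=\bar a_{n+m}=1-a_n-a_{n+m}$. Let $(q^k)_{k\in\mathbb N}$ be the trajectory of the junction dynamics (defined in the context) starting from $q^0=0$. Then for every $i\in\{1,\dots,n+m\}$ the sequence $(q_i^k)_{k\in\mathbb N}$ is nonnegative and nondecreasing in $k$.
   Context: All formulas are in ordinary arithmetic. The junction dynamics (traffic on two circular roads crossing at one junction) is the recursion on $q^k=(q^k_1,\dots,q^k_{n+m})\in\mathbb R^{n+m}$, $k\in\mathbb N$, given by $$\begin{cases} q_i^{k+1}=\min\{a_{i-1}+q_{i-1}^k,\ \bar a_i+q_{i+1}^k\}, & i\in\{1,\dots,n+m\}\setminus\{1,n,n+1,n+m\},\\ q_n^{k+1}=\min\{\bar a_n+q_1^k+q_{n+1}^k-q_{n+m}^k,\ a_{n-1}+q_{n-1}^k\},\\ q_{n+m}^{k+1}=\min\{\bar a_{n+m}+q_1^k+q_{n+1}^k-q_n^{k+1},\ a_{n+m-1}+q_{n+m-1}^k\},\\ q_1^{k+1}=\min\{a_n+\tfrac12(q_n^k+q_{n+m}^k),\ \bar a_1+q_2^k\},\\ q_{n+1}^{k+1}=\min\{a_{n+m}+\tfrac12(q_n^k+q_{n+m}^k),\ \bar a_{n+1}+q_{n+2}^k\}. \end{cases}$$ (The third line uses $q_n^{k+1}$, which is determined by the second line.) *)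

theory Defs
  imports Complex_Main
begin

definition abar :: "nat \<Rightarrow> nat \<Rightarrow> (nat \<Rightarrow> real) \<Rightarrow> nat \<Rightarrow> real" where
  "abar n m a i = (if i = n \<or> i = n + m then 1 - a n - a (n + m) else 1 - a i)"

(* Vectors in R^(n+m) are functions nat => real of which only the components 1..n+m are
   constrained or used.  The component q_i^k is written q k i. *)
definition junction_dynamics ::
  "nat \<Rightarrow> nat \<Rightarrow> (nat \<Rightarrow> real) \<Rightarrow> (nat \<Rightarrow> nat \<Rightarrow> real) \<Rightarrow> bool" where
  "junction_dynamics n m a q \<longleftrightarrow>
     (\<forall>k.
        (\<forall>i \<in> {1..n + m} - {1, n, n + 1, n + m}.
           q (k + 1) i = min (a (i - 1) + q k (i - 1)) (abar n m a i + q k (i + 1))) \<and>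
        q (k + 1) n =
          min (abar n m a n + q k 1 + q k (n + 1) - q k (n + m))
              (a (n - 1) + q k (n - 1)) \<and>
        q (k + 1) (n + m) =
          min (abar n m a (n + m) + q k 1 + q k (n + 1) - q (k + 1) n)
              (a (n + m - 1) + q k (n + m - 1)) \<and>
        q (k + 1) 1 =
          min (a n + 1 / 2 * (q k n + q k (n + m))) (abar n m a 1 + q k 2) \<and>
        q (k + 1) (n + 1) =
          min (a (n + m) + 1 / 2 * (q k n + q k (n + m)))
              (abar n m a (n + 1) + q k (n + 2)))"

end

theory Submission
  imports Defs
begin

text \<open>
  Call a state a subsolution if it satisfies the update equations, read as inequalities between
  the state and itself, where the two junction constraints (in which the update is not monotone)
  are replaced by the single inequality
  \<open>q\<^sub>n + q\<^sub>n\<^sub>+\<^sub>m \<le> 1 - a\<^sub>n - a\<^sub>n\<^sub>+\<^sub>m + q\<^sub>1 + q\<^sub>n\<^sub>+\<^sub>1\<close>.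
  The state 0 is a subsolution.  One step from a subsolution increases every component, the
  component \<open>n + m\<close> because the new value of \<open>q\<^sub>n\<close> is bounded using the old value of \<open>q\<^sub>n\<^sub>+\<^sub>m\<close>.
  Conversely, after an increasing step the new state is a subsolution, since the update of
  \<open>q\<^sub>n\<^sub>+\<^sub>m\<close> uses the new value of \<open>q\<^sub>n\<close>.
\<close>

definition subsolution :: "nat \<Rightarrow> nat \<Rightarrow> (nat \<Rightarrow> real) \<Rightarrow> (nat \<Rightarrow> real) \<Rightarrow> bool" where
  "subsolution n m a x \<longleftrightarrow>
     (\<forall>i \<in> {1..n + m} - {1, n, n + 1, n + m}.
        x i \<le> a (i - 1) + x (i - 1) \<and> x i \<le> abar n m a i + x (i + 1)) \<and>
     x n + x (n + m) \<le> 1 - a n - a (n + m) + x 1 + x (n + 1) \<and>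
     x n \<le> a (n - 1) + x (n - 1) \<and>
     x (n + m) \<le> a (n + m - 1) + x (n + m - 1) \<and>
     x 1 \<le> a n + 1 / 2 * (x n + x (n + m)) \<and>
     x 1 \<le> abar n m a 1 + x 2 \<and>
     x (n + 1) \<le> a (n + m) + 1 / 2 * (x n + x (n + m)) \<and>
     x (n + 1) \<le> abar n m a (n + 1) + x (n + 2)"

lemma abar_junction:
  "abar n m a n = 1 - a n - a (n + m)" "abar n m a (n + m) = 1 - a n - a (n + m)"
  by (simp_all add: abar_def)

lemma junction_dynamicsD:
  assumes "junction_dynamics n m a q"
  shows "i \<in> {1..n + m} - {1, n, n + 1, n + m} \<Longrightarrow>
      q (k + 1) i = min (a (i - 1) + q k (i - 1)) (abar n m a i + q k (i + 1))"
    and "q (k + 1) n = min (1 - a n - a (n + m) + q k 1 + q k (n + 1) - q k (n + m))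
      (a (n - 1) + q k (n - 1))"
    and "q (k + 1) (n + m) = min (1 - a n - a (n + m) + q k 1 + q k (n + 1) - q (k + 1) n)
      (a (n + m - 1) + q k (n + m - 1))"
    and "q (k + 1) 1 = min (a n + 1 / 2 * (q k n + q k (n + m))) (abar n m a 1 + q k 2)"
    and "q (k + 1) (n + 1) = min (a (n + m) + 1 / 2 * (q k n + q k (n + m)))
      (abar n m a (n + 1) + q k (n + 2))"
  using assms unfolding junction_dynamics_def abar_junction by blast+

text \<open>Every update is a minimum of two terms, and the subsolution inequalities say that the
  old value lies below each. For \<open>n\<close>, the junction inequality is solved for
  \<open>q k n\<close>.\<close>

lemma subsolution_increases:
  assumes dyn: "junction_dynamics n m a q" and sub: "subsolution n m a (q k)"
    and i: "i \<in> {1..n + m}"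
  shows "q k i \<le> q (k + 1) i"
proof -
  note D = junction_dynamicsD[OF dyn]
  have S: "q k n + q k (n + m) \<le> 1 - a n - a (n + m) + q k 1 + q k (n + 1)"
    "q k n \<le> a (n - 1) + q k (n - 1)"
    "q k (n + m) \<le> a (n + m - 1) + q k (n + m - 1)"
    "q k 1 \<le> a n + 1 / 2 * (q k n + q k (n + m))"
    "q k 1 \<le> abar n m a 1 + q k 2"
    "q k (n + 1) \<le> a (n + m) + 1 / 2 * (q k n + q k (n + m))"
    "q k (n + 1) \<le> abar n m a (n + 1) + q k (n + 2)"
    using sub unfolding subsolution_def by blast+
  consider "i \<in> {1..n + m} - {1, n, n + 1, n + m}" | "i = n" | "i = n + m" | "i = 1" | "i = n + 1"
    using i by blast
  then show ?thesis
  proof cases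
    case 1
    then show ?thesis using sub D(1)[OF 1, of k] unfolding subsolution_def by simp
  next
    case 2
    show ?thesis unfolding 2 using S D(2)[of k] by linarith
  next
    case 3
    \<comment> \<open>Inserted into the first term of the update of \<open>n + m\<close>, this bound
      cancels everything except \<open>q k (n + m)\<close>.\<close>
    have "q (k + 1) n \<le> 1 - a n - a (n + m) + q k 1 + q k (n + 1) - q k (n + m)"
      unfolding D(2) by (rule min.cobounded1)
    then show ?thesis unfolding 3 using S D(3)[of k] by linarith
  next
    case 4
    show ?thesis unfolding 4 using S D(4)[of k] by linarith
  next
    case 5
    show ?thesis unfolding 5 using S D(5)[of k] by linarith
  qed
qed

text \<open>A new component lies below terms evaluated at the old state; the increase lets the old
  values there be replaced by new ones.\<close>

lemma increasing_step_subsolution: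
  assumes "n \<ge> 2" "m \<ge> 2" and dyn: "junction_dynamics n m a q"
    and incr: "\<And>i. i \<in> {1..n + m} \<Longrightarrow> q k i \<le> q (k + 1) i"
  shows "subsolution n m a (q (k + 1))"
proof -
  note D = junction_dynamicsD[OF dyn]
  have "q (k + 1) i \<le> a (i - 1) + q (k + 1) (i - 1)"
    "q (k + 1) i \<le> abar n m a i + q (k + 1) (i + 1)"
    if i: "i \<in> {1..n + m} - {1, n, n + 1, n + m}" for i
  proof -
    have "i - 1 \<in> {1..n + m}" "i + 1 \<in> {1..n + m}"
      using i by auto
    from incr[OF this(1)] incr[OF this(2)]
    show "q (k + 1) i \<le> a (i - 1) + q (k + 1) (i - 1)"
      "q (k + 1) i \<le> abar n m a i + q (k + 1) (i + 1)"
      using D(1)[OF i, of k] by linarith+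
  qed
  \<comment> \<open>The bounds \<open>n \<ge> 2\<close> and \<open>m \<ge> 2\<close> keep
    \<open>n - 1\<close> and \<open>n + 2\<close> in range.\<close>
  moreover have mono: "q k n \<le> q (k + 1) n" "q k (n + m) \<le> q (k + 1) (n + m)"
    "q k 1 \<le> q (k + 1) 1" "q k 2 \<le> q (k + 1) 2"
    "q k (n + 1) \<le> q (k + 1) (n + 1)" "q k (n + 2) \<le> q (k + 1) (n + 2)"
    "q k (n - 1) \<le> q (k + 1) (n - 1)" "q k (n + m - 1) \<le> q (k + 1) (n + m - 1)"
    using assms(1,2) by (intro incr; auto)+
  moreover have "q (k + 1) n \<le> a (n - 1) + q (k + 1) (n - 1)"
    using D(2)[of k] mono by linarith
  \<comment> \<open>The subtracted term in the update of \<open>n + m\<close> is already the new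
    \<open>q (k + 1) n\<close>, so moving it to the left leaves only the terms at \<open>1\<close>
    and \<open>n + 1\<close> to be increased.\<close>
  moreover have
    "q (k + 1) n + q (k + 1) (n + m) \<le> 1 - a n - a (n + m) + q (k + 1) 1 + q (k + 1) (n + 1)"
    "q (k + 1) (n + m) \<le> a (n + m - 1) + q (k + 1) (n + m - 1)"
    using D(3)[of k] mono by linarith+
  moreover have half:
    "1 / 2 * (q k n + q k (n + m)) \<le> 1 / 2 * (q (k + 1) n + q (k + 1) (n + m))"
    using mono by simp
  moreover have "q (k + 1) 1 \<le> a n + 1 / 2 * (q (k + 1) n + q (k + 1) (n + m))"
    "q (k + 1) 1 \<le> abar n m a 1 + q (k + 1) 2"
    using D(4)[of k] mono half by linarith+
  moreover have
    "q (k + 1) (n + 1) \<le> a (n + m) + 1 / 2 * (q (k + 1) n + q (k + 1) (n + m))"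
    "q (k + 1) (n + 1) \<le> abar n m a (n + 1) + q (k + 1) (n + 2)"
    using D(5)[of k] mono half by linarith+
  ultimately show ?thesis
    unfolding subsolution_def by blast
qed

text \<open>At zero each inequality reduces to the nonnegativity of some \<open>a i\<close> or
  \<open>abar n m a i\<close>; at the junction this is
  \<open>a n + a (n + m) \<le> 1\<close>.\<close>

lemma subsolution_zero:
  assumes "n \<ge> 2" "m \<ge> 2"
    and a: "\<And>i. i \<in> {1..n + m} \<Longrightarrow> 0 \<le> a i \<and> a i \<le> 1" and "a n + a (n + m) \<le> 1"
    and zero: "\<And>i. i \<in> {1..n + m} \<Longrightarrow> x i = 0"
  shows "subsolution n m a x"
proof -
  have "0 \<le> abar n m a i" if "i \<in> {1..n + m}" for i
    using a[OF that] assms(4) by (simp add: abar_def)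
  moreover have "n - 1 \<in> {1..n + m}" "n + m - 1 \<in> {1..n + m}" "n + 2 \<in> {1..n + m}"
    using assms(1,2) by auto
  moreover have "i - 1 \<in> {1..n + m}" "i + 1 \<in> {1..n + m}"
    if "i \<in> {1..n + m} - {1, n, n + 1, n + m}" for i
    using that by auto
  ultimately show ?thesis
    using assms(1,2,4) a by (simp add: subsolution_def zero)
qed

theorem theorem5:
  fixes n m :: nat and a :: "nat \<Rightarrow> real" and q :: "nat \<Rightarrow> nat \<Rightarrow> real"
  assumes "n \<ge> 2" and "m \<ge> 2"
    and "\<forall>i \<in> {1..n + m}. 0 \<le> a i \<and> a i \<le> 1"
    and "a n + a (n + m) \<le> 1"
    and "junction_dynamics n m a q"
    and "\<forall>i \<in> {1..n + m}. q 0 i = 0"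
  shows "\<forall>i \<in> {1..n + m}. (\<forall>k. 0 \<le> q k i) \<and> incseq (\<lambda>k. q k i)"
proof
  have sub: "subsolution n m a (q k)" for k
  proof (induction k)
    case 0
    show ?case using assms by (intro subsolution_zero) auto
  next
    case (Suc k)
    then show ?case
      using increasing_step_subsolution[OF assms(1,2,5), of k] subsolution_increases[OF assms(5)]
      by simp
  qed
  fix i assume i: "i \<in> {1..n + m}"
  have inc: "incseq (\<lambda>k. q k i)"
    using subsolution_increases[OF assms(5) sub i] by (intro incseq_SucI) simp
  moreover have "0 \<le> q k i" for k
    using incseqD[OF inc, of 0 k] assms(6) i by simp
  ultimately show "(\<forall>k. 0 \<le> q k i) \<and> incseq (\<lambda>k. q k i)"
    by blast
qed

end
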